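(* For every real number $a$, every positive integer $m$ and every integer $n\ge 0$, $$B_n\left(\frac{-a}{m}\right)=\sum_{k=0}^{n}\sum_{j=0}^{k}\binom{k}{j}(mj-a)^n\frac{(-1)^j}{m^n(k+1)}.$$
   Context: $B_n(t)$ denotes the $n$-th Bernoulli polynomial, defined by $\sum_{n=0}^{\infty}B_n(t)\frac{z^n}{n!}=\frac{z e^{tz}}{e^z-1}$. The convention $0^0=1$ is used. *)

theory Defs
  imports Complex_Main "HOL-Computational_Algebra.Formal_Power_Series"
begin

text \<open>
  The generating function \<open>z e\<^sup>t\<^sup>z / (e\<^sup>z - 1)\<close> is read as a formal power series in \<open>z\<close>.
  The denominator has zero constant coefficient, so it is not a unit; the quotient is nevertheless
  exact because numerator and denominator are both divisible by \<open>z\<close>: see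
  \<open>bernoulli_gf_times_denominator\<close>.
\<close>

definition bernoulli_gf :: "real \<Rightarrow> real fps" where
  "bernoulli_gf t = fps_X * fps_exp t / (fps_exp 1 - 1)"

definition bernoulli_poly :: "nat \<Rightarrow> real \<Rightarrow> real" where
  "bernoulli_poly n t = fact n * fps_nth (bernoulli_gf t) n"

lemma bernoulli_gf_times_denominator:
  "bernoulli_gf t * (fps_exp 1 - 1) = fps_X * fps_exp t"
proof -
  let ?d = "fps_exp 1 - 1 :: real fps"
  have d1: "fps_nth ?d 1 \<noteq> 0" by simp
  then have nz: "?d \<noteq> 0" by (metis fps_zero_nth)
  have "subdegree ?d = 1"
    by (rule subdegreeI) (use d1 in auto)
  moreover have "subdegree (fps_X * fps_exp t :: real fps) = 1"
    by (rule subdegreeI) auto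
  ultimately have "?d dvd fps_X * fps_exp t"
    using nz by (subst fps_dvd_iff) auto
  then show ?thesis
    unfolding bernoulli_gf_def by (rule dvd_div_mult_self)
qed

lemma bernoulli_poly_egf:
  "Abs_fps (\<lambda>n. bernoulli_poly n t / fact n) = fps_X * fps_exp t / (fps_exp 1 - 1)"
  by (simp add: fps_eq_iff bernoulli_poly_def bernoulli_gf_def)

end

(* With t = - a / m and d = exp z - 1, the inverse of composition with the logarithm series gives
   z / d = (\<Sum>k. (-1)^k / (k + 1) * d^k).  Multiplying by exp (t z) and expanding d^k binomially
   turns the k-th summand into a combination of exp ((t + j) z) with j \<le> k; since d^k is divisible
   by z^k, only the indices k \<le> n contribute to the coefficient of z^n. *)
theory Submission
  imports Defs
begin

text \<open>\<open>g ^ k\<close> has no coefficient below index \<open>k\<close>, so for every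
  \<open>i\<close> \<le> \<open>n\<close> the sum defining the coefficient of \<open>f oo g\<close>
  extends by zeros to the common range \<open>k\<close> \<le> \<open>n\<close>; with that range
  fixed, the two summations can be swapped.\<close>

lemma fps_compose_mult_nth:
  fixes f g h :: "'a::comm_ring_1 fps"
  assumes "fps_nth g 0 = 0"
  shows "fps_nth ((f oo g) * h) n = (\<Sum>k=0..n. fps_nth f k * fps_nth (g ^ k * h) n)"
proof -
  have ext: "fps_nth (f oo g) i = (\<Sum>k=0..n. fps_nth f k * fps_nth (g ^ k) i)" if "i \<le> n" for i
    unfolding fps_compose_nth
    by (rule sum.mono_neutral_left) (use that startsby_zero_power_prefix[OF assms] in auto)
  have "fps_nth ((f oo g) * h) n
      = (\<Sum>i=0..n. \<Sum>k=0..n. fps_nth f k * (fps_nth (g ^ k) i * fps_nth h (n - i)))"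
    by (simp add: fps_mult_nth ext sum_distrib_right mult.assoc)
  also have "\<dots> = (\<Sum>k=0..n. fps_nth f k * fps_nth (g ^ k * h) n)"
    by (subst sum.swap) (simp add: fps_mult_nth sum_distrib_left)
  finally show ?thesis .
qed

lemma fps_X_eq_exp_minus_1_mult:
  "(fps_X :: 'a::field_char_0 fps) =
    (fps_exp 1 - 1) * (Abs_fps (\<lambda>k. (- 1) ^ k / of_nat (Suc k)) oo (fps_exp 1 - 1))"
proof -
  let ?d = "fps_exp 1 - 1 :: 'a fps" and ?L = "Abs_fps (\<lambda>k. (- 1) ^ k / of_nat (Suc k)) :: 'a fps"
  \<comment> \<open>\<open>fps_ln 1\<close> is the series of log(1 + z), the compositional inverse
    of \<open>?d\<close>; its zero constant term lets a factor \<open>fps_X\<close> be split off,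
    which leaves \<open>?L\<close>.\<close>
  have "fps_X = fps_ln 1 oo ?d"
    by (simp add: fps_ln_fps_exp_inv fps_inv)
  also have "fps_ln 1 = fps_X * ?L"
    by (rule fps_ext) (auto simp: fps_ln_def split: nat.split)
  also have "(fps_X * ?L) oo ?d = ?d * (?L oo ?d)"
    by (simp add: fps_compose_mult_distrib)
  finally show ?thesis .
qed

text \<open>Both sides times exp z - 1 equal z exp(t z), and this nonzero factor cancels because
  real power series form an integral domain.\<close>

lemma bernoulli_gf_eq_compose:
  "bernoulli_gf t = (Abs_fps (\<lambda>k. (- 1) ^ k / real (Suc k)) oo (fps_exp 1 - 1)) * fps_exp t"
proof -
  let ?d = "fps_exp 1 - 1 :: real fps"
  have "fps_nth ?d 1 \<noteq> 0" by simp
  then have nz: "?d \<noteq> 0" by (metis fps_zero_nth)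
  have "bernoulli_gf t * ?d =
      (Abs_fps (\<lambda>k. (- 1) ^ k / real (Suc k)) oo ?d) * fps_exp t * ?d"
    by (subst bernoulli_gf_times_denominator, subst fps_X_eq_exp_minus_1_mult)
      (simp only: mult_ac)
  with nz show ?thesis by simp
qed

lemma fps_exp_minus_1_power_mult_nth:
  fixes t :: "'a::field_char_0"
  shows "fps_nth ((fps_exp 1 - 1) ^ k * fps_exp t) n =
    (\<Sum>j=0..k. of_nat (k choose j) * (- 1) ^ (k - j) * (t + of_nat j) ^ n / fact n)"
proof -
  have "(fps_exp 1 - 1) ^ k * fps_exp t =
      (\<Sum>j=0..k. of_nat (k choose j) * fps_exp 1 ^ j * (- 1) ^ (k - j) * fps_exp t)"
    using binomial_ring[of "fps_exp (1::'a)" "- 1" k]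
    by (simp add: sum_distrib_right atLeast0AtMost)
  also have "\<dots> =
      (\<Sum>j=0..k. fps_const (of_nat (k choose j) * (- 1) ^ (k - j)) * fps_exp (t + of_nat j))"
  proof (rule sum.cong)
    fix j
    \<comment> \<open>Sign and binomial coefficient become constant series, so that they merge into
      one scalar in front of a single exponential.\<close>
    have "(- 1 :: 'a fps) ^ (k - j) = fps_const ((- 1) ^ (k - j))"
      by (metis fps_const_1_eq_1 fps_const_neg fps_const_power)
    moreover have "fps_exp t * fps_exp 1 ^ j = fps_exp (t + of_nat j)"
      by (simp add: fps_exp_power_mult fps_exp_add_mult)
    moreover have "(of_nat (k choose j) :: 'a fps) = fps_const (of_nat (k choose j))"
      by (simp add: fps_of_nat)
    ultimately show "of_nat (k choose j) * fps_exp 1 ^ j * (- 1) ^ (k - j) * fps_exp t =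
        fps_const (of_nat (k choose j) * (- 1) ^ (k - j)) * fps_exp (t + of_nat j)"
      by (metis (no_types) fps_const_mult mult.assoc mult.commute)
  qed simp
  finally show ?thesis
    by (simp add: fps_sum_nth)
qed

lemma bernoulli_poly_double_sum:
  "bernoulli_poly n t =
    (\<Sum>k=0..n. \<Sum>j=0..k. real (k choose j) * (t + real j) ^ n * ((- 1) ^ j / (real k + 1)))"
proof -
  \<comment> \<open>The logarithm series contributes \<open>(- 1) ^ k\<close> and the binomial
    expansion \<open>(- 1) ^ (k - j)\<close>; 2k - j has the parity of j.\<close>
  have sgn: "(- 1) ^ k * (- 1) ^ (k - j) = (- 1 :: real) ^ j" if "j \<le> k" for j k :: nat
    using that by (simp add: minus_one_power_iff)
  have "bernoulli_poly n t =
      (\<Sum>k=0..n. \<Sum>j=0..k. real (k choose j) * (t + real j) ^ n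
        * (((- 1) ^ k * (- 1) ^ (k - j)) / (real k + 1)))"
    unfolding bernoulli_poly_def bernoulli_gf_eq_compose
    by (subst fps_compose_mult_nth, simp, unfold fps_exp_minus_1_power_mult_nth)
      (simp add: sum_distrib_left mult_ac add_ac)
  then show ?thesis
    by (simp add: sgn)
qed

theorem mainTheorem3:
  fixes a :: real and m n :: nat
  assumes "m > 0"
  shows "bernoulli_poly n (- a / real m) =
    (\<Sum>k = 0..n. \<Sum>j = 0..k.
      real (k choose j) * (real m * real j - a) ^ n * ((- 1) ^ j / (real m ^ n * (real k + 1))))"
proof -
  \<comment> \<open>The common denominator \<open>real m\<close>, raised to the power
    \<open>n\<close>, yields the factor \<open>real m ^ n\<close>.\<close>
  have "- a / real m + real j = (real m * real j - a) / real m" for j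
    using assms by (simp add: field_simps)
  then show ?thesis
    unfolding bernoulli_poly_double_sum by (simp add: power_divide)
qed

end
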